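(* Let $(X,\mathsf a)$ be a complete action space. Then every curve $u:[a,b]\to X$ with finite action $\mathbb A(u;[a,b])<+\infty$ satisfies the following: for every $t\in(a,b]$ the left limit $u_-(t):=\lim_{s\uparrow t}u(s)$ exists in the topology $\mathfrak O$, and for every $t\in[a,b)$ the right limit $u_+(t):=\lim_{s\downarrow t}u(s)$ exists in the topology $\mathfrak O$ (with the convention $u_-(a):=u(a)$ and $u_+(b):=u(b)$). Furthermore, the pointwise jump set $$\mathrm J_u:=\mathrm J_u^+\cup\mathrm J_u^-,\qquad \mathrm J_u^-:=\{t\in[a,b]:u_-(t)\ne u(t)\},\quad \mathrm J_u^+:=\{t\in[a,b]:u(t)\ne u_+(t)\},$$ consists of at most countably many points, and the function $\mathsf A_u:[a,b]\to[0,+\infty)$, $\mathsf A_u(t):=\mathbb A(u;[a,t])$, has bounded variation.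
   Context: An action cost on a set $X$ is a function $\mathsf a:(0,+\infty)\times X\times X\to[0,+\infty)$ such that for all $\tau,\tau_1,\tau_2>0$ and $u_1,u_2,u_3\in X$: (i) $\mathsf a(\tau,u_1,u_2)=0$ if and only if $u_1=u_2$; (ii) $\mathsf a(\tau,u_1,u_2)=\mathsf a(\tau,u_2,u_1)$; (iii) $\mathsf a(\tau_1+\tau_2,u_1,u_3)\le \mathsf a(\tau_1,u_1,u_2)+\mathsf a(\tau_2,u_2,u_3)$. The pair $(X,\mathsf a)$ is called an action space. The topology $\mathfrak O$ induced by $\mathsf a$ is the (Hausdorff, first countable) topology for which the neighborhoods of $u\in X$ are exactly the sets containing $\{v\in X:\mathsf a(\tau,u,v)<c\}$ for some $\tau,c>0$; thus $u_n\to u$ iff $\mathsf a(\tau,u_n,u)\to0$ for every $\tau>0$. A sequence $(u_n)$ is Cauchy if for all $\tau,c>0$ there is $\bar n$ with $\mathsf a(\tau,u_n,u_m)<c$ for all $n,m\ge\bar n$; $(X,\mathsf a)$ is complete if every Cauchy sequence converges. The $\mathsf a$-action of a curve $u:[a,b]\to X$ is $\mathbb A(u;[a,b]):=\sup\sum_{j=1}^M\mathsf a(t^j-t^{j-1},u(t^{j-1}),u(t^j))$, the supremum being over all finite partitions $a=t^0<t^1<\dots<t^M=b$ (and $\mathbb A(u;[a,a])=0$). *)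

theory Defs
  imports "HOL-Analysis.Analysis"
begin

text \<open>The partition \<open>a = t 0 < t 1 < \<dots> < t M = b\<close>. The case \<open>M = 0\<close> occurs exactly when
  \<open>a = b\<close>.\<close>

definition interval_partition :: "real \<Rightarrow> real \<Rightarrow> nat \<Rightarrow> (nat \<Rightarrow> real) \<Rightarrow> bool"
  where "interval_partition a b M t \<longleftrightarrow> t 0 = a \<and> t M = b \<and> (\<forall>j<M. t j < t (Suc j))"

definition bounded_variation_on_interval :: "(real \<Rightarrow> real) \<Rightarrow> real \<Rightarrow> real \<Rightarrow> bool"
  where "bounded_variation_on_interval f a b \<longleftrightarrow>
    (\<exists>C. \<forall>M t. interval_partition a b M t \<longrightarrow> (\<Sum>j<M. \<bar>f (t (Suc j)) - f (t j)\<bar>) \<le> C)"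

locale action_space =
  fixes X :: "'a set" and cost :: "real \<Rightarrow> 'a \<Rightarrow> 'a \<Rightarrow> real"
  assumes cost_nonneg: "\<lbrakk>\<tau> > 0; u \<in> X; v \<in> X\<rbrakk> \<Longrightarrow> 0 \<le> cost \<tau> u v"
    and cost_zero_iff: "\<lbrakk>\<tau> > 0; u \<in> X; v \<in> X\<rbrakk> \<Longrightarrow> cost \<tau> u v = 0 \<longleftrightarrow> u = v"
    and cost_sym: "\<lbrakk>\<tau> > 0; u \<in> X; v \<in> X\<rbrakk> \<Longrightarrow> cost \<tau> u v = cost \<tau> v u"
    and cost_triangle: "\<lbrakk>\<tau>\<^sub>1 > 0; \<tau>\<^sub>2 > 0; u \<in> X; v \<in> X; w \<in> X\<rbrakk>
      \<Longrightarrow> cost (\<tau>\<^sub>1 + \<tau>\<^sub>2) u w \<le> cost \<tau>\<^sub>1 u v + cost \<tau>\<^sub>2 v w"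
begin

definition action_ball :: "'a \<Rightarrow> real \<Rightarrow> real \<Rightarrow> 'a set"
  where "action_ball u \<tau> c = {v \<in> X. cost \<tau> u v < c}"

text \<open>The action balls need not be open. A set is open iff it contains an action ball around each
  of its points; \<open>neighbourhood_iff\<close> below shows that the neighbourhoods of \<open>u\<close> are then exactly
  the sets containing an action ball around \<open>u\<close>.\<close>

definition action_topology :: "'a topology"
  where "action_topology =
    topology (\<lambda>U. U \<subseteq> X \<and> (\<forall>u\<in>U. \<exists>\<tau>>0. \<exists>c>0. action_ball u \<tau> c \<subseteq> U))"

definition action_Cauchy :: "(nat \<Rightarrow> 'a) \<Rightarrow> bool"
  where "action_Cauchy \<sigma> \<longleftrightarrow> range \<sigma> \<subseteq> X \<and>
    (\<forall>\<tau>>0. \<forall>c>0. \<exists>N. \<forall>n\<ge>N. \<forall>m\<ge>N. cost \<tau> (\<sigma> n) (\<sigma> m) < c)"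

definition action_complete :: bool
  where "action_complete \<longleftrightarrow>
    (\<forall>\<sigma>. action_Cauchy \<sigma> \<longrightarrow> (\<exists>u. limitin action_topology \<sigma> u sequentially))"

text \<open>For \<open>a = b\<close> the only sum is the empty one, so the action is \<open>0\<close> (\<open>action_refl\<close> below).\<close>

definition action :: "(real \<Rightarrow> 'a) \<Rightarrow> real \<Rightarrow> real \<Rightarrow> ennreal"
  where "action u a b =
    (SUP (M, t)\<in>{(M, t). interval_partition a b M t}.
      ennreal (\<Sum>j<M. cost (t (Suc j) - t j) (u (t j)) (u (t (Suc j)))))"

text \<open>One-sided limits of a curve on \<open>[a,b]\<close>, with the endpoint conventions \<open>u\<^sub>-(a) = u(a)\<close>
  and \<open>u\<^sub>+(b) = u(b)\<close>. Limits are unique by \<open>Hausdorff_action_topology\<close> below.\<close>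

definition left_limit :: "(real \<Rightarrow> 'a) \<Rightarrow> real \<Rightarrow> real \<Rightarrow> 'a"
  where "left_limit u a t =
    (if t = a then u a else (THE l. limitin action_topology u l (at_left t)))"

definition right_limit :: "(real \<Rightarrow> 'a) \<Rightarrow> real \<Rightarrow> real \<Rightarrow> 'a"
  where "right_limit u b t =
    (if t = b then u b else (THE l. limitin action_topology u l (at_right t)))"

definition left_jump_set :: "(real \<Rightarrow> 'a) \<Rightarrow> real \<Rightarrow> real \<Rightarrow> real set"
  where "left_jump_set u a b = {t \<in> {a..b}. left_limit u a t \<noteq> u t}"

definition right_jump_set :: "(real \<Rightarrow> 'a) \<Rightarrow> real \<Rightarrow> real \<Rightarrow> real set"
  where "right_jump_set u a b = {t \<in> {a..b}. u t \<noteq> right_limit u b t}"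

definition jump_set :: "(real \<Rightarrow> 'a) \<Rightarrow> real \<Rightarrow> real \<Rightarrow> real set"
  where "jump_set u a b = right_jump_set u a b \<union> left_jump_set u a b"

lemma cost_antimono:
  assumes "0 < \<tau>" "\<tau> \<le> \<tau>'" "u \<in> X" "v \<in> X"
  shows "cost \<tau>' u v \<le> cost \<tau> u v"
proof (cases "\<tau> = \<tau>'")
  case False
  then have "cost (\<tau> + (\<tau>' - \<tau>)) u v \<le> cost \<tau> u v + cost (\<tau>' - \<tau>) v v"
    using assms by (intro cost_triangle) auto
  moreover have "cost (\<tau>' - \<tau>) v v = 0"
    using cost_zero_iff[of "\<tau>' - \<tau>" v v] False assms by auto
  ultimately show ?thesis by simp
qed simp

lemma action_ball_mono:
  assumes "0 < \<tau>" "\<tau> \<le> \<tau>'" "c \<le> c'" "u \<in> X"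
  shows "action_ball u \<tau> c \<subseteq> action_ball u \<tau>' c'"
  using cost_antimono[OF assms(1,2,4)] assms(3) unfolding action_ball_def by fastforce

lemma centre_in_action_ball:
  assumes "\<tau> > 0" "c > 0" "u \<in> X"
  shows "u \<in> action_ball u \<tau> c"
  using cost_zero_iff[of \<tau> u u] assms by (auto simp: action_ball_def)

lemma istopology_action:
  "istopology (\<lambda>U. U \<subseteq> X \<and> (\<forall>u\<in>U. \<exists>\<tau>>0. \<exists>c>0. action_ball u \<tau> c \<subseteq> U))"
  unfolding istopology_def
proof (intro conjI allI impI)
  fix S T
  assume S: "S \<subseteq> X \<and> (\<forall>u\<in>S. \<exists>\<tau>>0. \<exists>c>0. action_ball u \<tau> c \<subseteq> S)"
    and T: "T \<subseteq> X \<and> (\<forall>u\<in>T. \<exists>\<tau>>0. \<exists>c>0. action_ball u \<tau> c \<subseteq> T)"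
  show "S \<inter> T \<subseteq> X" using S by blast
  show "\<forall>u\<in>S \<inter> T. \<exists>\<tau>>0. \<exists>c>0. action_ball u \<tau> c \<subseteq> S \<inter> T"
  proof
    fix u assume u: "u \<in> S \<inter> T"
    then have uX: "u \<in> X" using S by auto
    obtain \<tau> c where 1: "\<tau> > 0" "c > 0" "action_ball u \<tau> c \<subseteq> S" using u S by blast
    obtain \<tau>' c' where 2: "\<tau>' > 0" "c' > 0" "action_ball u \<tau>' c' \<subseteq> T" using u T by blast
    have "action_ball u (min \<tau> \<tau>') (min c c') \<subseteq> action_ball u \<tau> c"
      "action_ball u (min \<tau> \<tau>') (min c c') \<subseteq> action_ball u \<tau>' c'"
      by (rule action_ball_mono; use 1 2 uX in simp)+
    then have "action_ball u (min \<tau> \<tau>') (min c c') \<subseteq> S \<inter> T" using 1(3) 2(3) by blast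
    moreover have "min \<tau> \<tau>' > 0" "min c c' > 0" using 1 2 by simp_all
    ultimately show "\<exists>\<tau>>0. \<exists>c>0. action_ball u \<tau> c \<subseteq> S \<inter> T" by metis
  qed
next
  fix \<K>
  assume K: "\<forall>K\<in>\<K>. K \<subseteq> X \<and> (\<forall>u\<in>K. \<exists>\<tau>>0. \<exists>c>0. action_ball u \<tau> c \<subseteq> K)"
  then show "\<Union>\<K> \<subseteq> X" by blast
  show "\<forall>u\<in>\<Union>\<K>. \<exists>\<tau>>0. \<exists>c>0. action_ball u \<tau> c \<subseteq> \<Union>\<K>"
  proof
    fix u assume "u \<in> \<Union>\<K>"
    then obtain K where "K \<in> \<K>" "u \<in> K" by blast
    then obtain \<tau> c where "\<tau> > 0" "c > 0" "action_ball u \<tau> c \<subseteq> K" using K by blast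
    then show "\<exists>\<tau>>0. \<exists>c>0. action_ball u \<tau> c \<subseteq> \<Union>\<K>" using \<open>K \<in> \<K>\<close> by blast
  qed
qed

lemma openin_action_topology:
  "openin action_topology U \<longleftrightarrow> U \<subseteq> X \<and> (\<forall>u\<in>U. \<exists>\<tau>>0. \<exists>c>0. action_ball u \<tau> c \<subseteq> U)"
  unfolding action_topology_def topology_inverse'[OF istopology_action] ..

lemma topspace_action_topology [simp]: "topspace action_topology = X"
proof
  show "topspace action_topology \<subseteq> X"
    using openin_topspace[of action_topology] unfolding openin_action_topology by blast
  have "openin action_topology X"
    unfolding openin_action_topology action_ball_def
    by (auto intro!: exI[of _ "1::real"])
  then show "X \<subseteq> topspace action_topology" by (rule openin_subset)
qed

lemma neighbourhood_iff:
  assumes u: "u \<in> X" and N: "N \<subseteq> X"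
  shows "(\<exists>U. openin action_topology U \<and> u \<in> U \<and> U \<subseteq> N) \<longleftrightarrow>
    (\<exists>\<tau>>0. \<exists>c>0. action_ball u \<tau> c \<subseteq> N)" (is "?L \<longleftrightarrow> ?R")
proof
  assume ?L
  then show ?R unfolding openin_action_topology by (meson subset_trans)
next
  assume ?R
  define U where "U = {v \<in> X. \<exists>\<tau>>0. \<exists>c>0. action_ball v \<tau> c \<subseteq> N}"
  have "openin action_topology U"
    unfolding openin_action_topology
  proof (intro conjI ballI)
    show "U \<subseteq> X" by (auto simp: U_def)
    fix v assume "v \<in> U"
    then obtain \<tau> c where v: "v \<in> X" "\<tau> > 0" "c > 0" "action_ball v \<tau> c \<subseteq> N"
      by (auto simp: U_def)
    have "action_ball v (\<tau>/2) (c/2) \<subseteq> U"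
    proof
      fix w assume "w \<in> action_ball v (\<tau>/2) (c/2)"
      then have w: "w \<in> X" "cost (\<tau>/2) v w < c/2" by (auto simp: action_ball_def)
      have "action_ball w (\<tau>/2) (c/2) \<subseteq> action_ball v \<tau> c"
      proof
        fix x assume "x \<in> action_ball w (\<tau>/2) (c/2)"
        then have x: "x \<in> X" "cost (\<tau>/2) w x < c/2" by (auto simp: action_ball_def)
        have "cost (\<tau>/2 + \<tau>/2) v x \<le> cost (\<tau>/2) v w + cost (\<tau>/2) w x"
          using v w x by (intro cost_triangle) auto
        then show "x \<in> action_ball v \<tau> c" using w x by (simp add: action_ball_def)
      qed
      then have "action_ball w (\<tau>/2) (c/2) \<subseteq> N" using v by blast
      moreover have "\<tau>/2 > 0" "c/2 > 0" using v by auto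
      ultimately have "\<exists>\<tau>>0. \<exists>c>0. action_ball w \<tau> c \<subseteq> N" by metis
      then show "w \<in> U" using w by (simp add: U_def)
    qed
    moreover have "\<tau>/2 > 0" "c/2 > 0" using v by auto
    ultimately show "\<exists>\<tau>>0. \<exists>c>0. action_ball v \<tau> c \<subseteq> U" by metis
  qed
  moreover have "u \<in> U" using \<open>?R\<close> u by (simp add: U_def)
  moreover have "U \<subseteq> N" unfolding U_def using centre_in_action_ball by blast
  ultimately show ?L by blast
qed

lemma limitin_action_topology:
  "limitin action_topology f u F \<longleftrightarrow>
    u \<in> X \<and> (\<forall>\<tau>>0. \<forall>c>0. eventually (\<lambda>x. f x \<in> X \<and> cost \<tau> (f x) u < c) F)"
proof (cases "u \<in> X")
  case True
  have "(\<forall>U. openin action_topology U \<and> u \<in> U \<longrightarrow> (\<forall>\<^sub>F x in F. f x \<in> U)) \<longleftrightarrow>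
      (\<forall>\<tau>>0. \<forall>c>0. \<forall>\<^sub>F x in F. f x \<in> action_ball u \<tau> c)" (is "?L \<longleftrightarrow> ?R")
  proof
    assume L: ?L
    show ?R
    proof (intro allI impI)
      fix \<tau> c :: real assume "\<tau> > 0" "c > 0"
      then have "\<exists>U. openin action_topology U \<and> u \<in> U \<and> U \<subseteq> action_ball u \<tau> c"
        using True by (subst neighbourhood_iff) (auto simp: action_ball_def)
      then obtain U where U: "openin action_topology U" "u \<in> U" "U \<subseteq> action_ball u \<tau> c" by blast
      then have "\<forall>\<^sub>F x in F. f x \<in> U" using L by blast
      then show "\<forall>\<^sub>F x in F. f x \<in> action_ball u \<tau> c"
        by (rule eventually_mono) (use U in blast)
    qed
  next
    assume R: ?R
    show ?L
    proof (intro allI impI)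
      fix U assume "openin action_topology U \<and> u \<in> U"
      then obtain \<tau> c where U: "\<tau> > 0" "c > 0" "action_ball u \<tau> c \<subseteq> U"
        unfolding openin_action_topology by blast
      then have "\<forall>\<^sub>F x in F. f x \<in> action_ball u \<tau> c" using R by blast
      then show "\<forall>\<^sub>F x in F. f x \<in> U" by (rule eventually_mono) (use U in blast)
    qed
  qed
  moreover have "f x \<in> action_ball u \<tau> c \<longleftrightarrow> f x \<in> X \<and> cost \<tau> (f x) u < c" if "\<tau> > 0" for x \<tau> c
    using True that cost_sym[of \<tau> "f x" u] by (auto simp: action_ball_def)
  ultimately show ?thesis using True by (simp add: limitin_def)
qed (simp add: limitin_def)

lemma Hausdorff_action_topology: "Hausdorff_space action_topology"
  unfolding Hausdorff_space_def
proof (intro allI impI)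
  fix u v assume "u \<in> topspace action_topology \<and> v \<in> topspace action_topology \<and> u \<noteq> v"
  then have uv: "u \<in> X" "v \<in> X" "u \<noteq> v" by auto
  define c where "c = cost 2 u v / 2"
  have c: "c > 0" using cost_nonneg[of 2 u v] cost_zero_iff[of 2 u v] uv by (simp add: c_def)
  have nbhd: "\<exists>U. openin action_topology U \<and> w \<in> U \<and> U \<subseteq> action_ball w 1 c" if "w \<in> X" for w
  proof (subst neighbourhood_iff[OF that])
    show "action_ball w 1 c \<subseteq> X" by (auto simp: action_ball_def)
    show "\<exists>\<tau>>0. \<exists>d>0. action_ball w \<tau> d \<subseteq> action_ball w 1 c"
      using c zero_less_one[where 'a = real] by blast
  qed
  from nbhd[OF uv(1)] nbhd[OF uv(2)] obtain U V where UV: "openin action_topology U" "u \<in> U" "U \<subseteq> action_ball u 1 c"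
    "openin action_topology V" "v \<in> V" "V \<subseteq> action_ball v 1 c" by blast
  have "action_ball u 1 c \<inter> action_ball v 1 c = {}"
  proof (rule ccontr)
    assume "\<not> ?thesis"
    then obtain w where w: "w \<in> X" "cost 1 u w < c" "cost 1 v w < c"
      by (auto simp: action_ball_def)
    have "cost (1 + 1) u v \<le> cost 1 u w + cost 1 w v" using uv w by (intro cost_triangle) auto
    then show False using w uv cost_sym[of 1 v w] by (simp add: c_def)
  qed
  then show "\<exists>U V. openin action_topology U \<and> openin action_topology V \<and>
      u \<in> U \<and> v \<in> V \<and> disjnt U V"
    using UV unfolding disjnt_def by blast
qed

lemma left_limit_eqI:
  assumes "limitin action_topology u l (at_left t)" "t \<noteq> a"
  shows "left_limit u a t = l"
proof -
  have "(THE l. limitin action_topology u l (at_left t)) = l"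
  proof (rule the_equality)
    show "limitin action_topology u l (at_left t)" by fact
    show "l' = l" if "limitin action_topology u l' (at_left t)" for l'
      by (rule limitin_Hausdorff_unique[OF that assms(1) _ Hausdorff_action_topology]) simp
  qed
  then show ?thesis using assms(2) by (simp add: left_limit_def)
qed

lemma right_limit_eqI:
  assumes "limitin action_topology u l (at_right t)" "t \<noteq> b"
  shows "right_limit u b t = l"
proof -
  have "(THE l. limitin action_topology u l (at_right t)) = l"
  proof (rule the_equality)
    show "limitin action_topology u l (at_right t)" by fact
    show "l' = l" if "limitin action_topology u l' (at_right t)" for l'
      by (rule limitin_Hausdorff_unique[OF that assms(1) _ Hausdorff_action_topology]) simp
  qed
  then show ?thesis using assms(2) by (simp add: right_limit_def)
qed

lemma action_refl: "action u a a = 0"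
proof -
  have "M = 0" if "interval_partition a a M t" for M t
  proof (rule ccontr)
    assume M: "M \<noteq> 0"
    have "j = 0 \<or> t 0 < t j" if "j \<le> M" for j
      using that
    proof (induction j)
      case (Suc j)
      then have "t j < t (Suc j)"
        using \<open>interval_partition a a M t\<close> by (simp add: interval_partition_def)
      moreover have "j = 0 \<or> t 0 < t j" using Suc by simp
      ultimately show ?case by auto
    qed simp
    from this[of M] show False
      using M \<open>interval_partition a a M t\<close> by (simp add: interval_partition_def)
  qed
  then have "action u a a \<le> 0"
    unfolding action_def by (intro SUP_least) fastforce
  then show ?thesis by simp
qed

end

end

theory Submission
  imports Defs
begin

text \<open>
  Let \<open>A t\<close> be the action of the curve on \<open>[a,t]\<close>. Appending the point \<open>t\<close> to a
  partition of \<open>[a,s]\<close> gives a partition of \<open>[a,t]\<close>, so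
  \<open>cost (t - s) (u s) (u t) \<le> A t - A s\<close> for \<open>s < t\<close> (\<open>action_extend\<close>). Hence \<open>A\<close> is
  nondecreasing, which already yields finiteness and bounded variation, and every other claim
  only uses that some real function \<open>F\<close> controls the curve through this inequality (the locale
  \<open>controlled_curve\<close>).

  A nondecreasing \<open>F\<close> has one-sided limits, so near \<open>t\<close> on one side its increments are small.
  When \<open>s, s'\<close> tend to \<open>t\<close>, the time step in the control inequality becomes shorter than any
  prescribed \<open>\<tau>\<close>; since the cost decreases in \<open>\<tau>\<close>, also \<open>cost \<tau> (u s) (u s')\<close> is small for every
  \<open>\<tau>\<close>. The curve is therefore Cauchy as \<open>s\<close> tends to \<open>t\<close> from one side, and it converges by
  completeness (\<open>Cauchy_filter_converges\<close>).
  If moreover \<open>F\<close> is continuous at \<open>t\<close>, the same estimate with \<open>s' = t\<close> identifies the limit as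
  \<open>u t\<close>. Jumps of the curve thus occur only at discontinuities of \<open>F\<close>, of which a monotone
  function has countably many.
\<close>

section \<open>Partitions of an interval\<close>

lemma interval_partition_exists:
  assumes "a \<le> b"
  shows "\<exists>M t. interval_partition a b M t"
proof (cases "a = b")
  case True
  then show ?thesis
    by (intro exI[of _ 0] exI[of _ "\<lambda>_. a"]) (simp add: interval_partition_def)
next
  case False
  then show ?thesis using assms
    by (intro exI[of _ 1] exI[of _ "\<lambda>j. if j = 0 then a else b"])
      (simp add: interval_partition_def)
qed

lemma interval_partition_bounds:
  assumes "interval_partition a b M t" "j \<le> M"
  shows "t j \<in> {a..b}"
proof -
  have mono: "t i \<le> t k" if "i \<le> k" "k \<le> M" for i k
    using that
  proof (induction k rule: dec_induct)
    case (step k)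
    then have "t k < t (Suc k)" using assms(1) by (simp add: interval_partition_def)
    then show ?case using step by simp
  qed simp
  show ?thesis
    using mono[of 0 j] mono[of j M] assms by (simp add: interval_partition_def)
qed

lemma interval_partition_snoc:
  assumes "interval_partition a s M p" "s < t"
  shows "interval_partition a t (Suc M) (p(Suc M := t))"
  using assms by (auto simp: interval_partition_def less_Suc_eq)

section \<open>Convergence along Cauchy filters\<close>

context action_space
begin

lemma cost_self [simp]: "\<tau> > 0 \<Longrightarrow> x \<in> X \<Longrightarrow> cost \<tau> x x = 0"
  using cost_zero_iff by blast

text \<open>Completeness speaks of sequences, but the limits needed are along one-sided neighbourhoods.
  Because the cost decreases in \<open>\<tau>\<close>, the countably many scales \<open>\<tau> = c = 1 / (n + 1)\<close> govern all
  others. Each scale comes with a set of the filter on which \<open>u\<close> varies little at that scale; if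
  the \<open>n\<close>-th term is chosen in the sets of all scales up to \<open>n\<close>, the resulting sequence is Cauchy,
  and its limit is the limit along the whole filter.\<close>

lemma Cauchy_filter_converges:
  assumes complete: action_complete
    and nontrivial: "G \<noteq> bot"
    and Cauchy: "\<And>\<tau> c. \<tau> > 0 \<Longrightarrow> c > 0 \<Longrightarrow> \<exists>P. eventually P G \<and>
      (\<forall>x y. P x \<longrightarrow> P y \<longrightarrow> u x \<in> X \<and> u y \<in> X \<and> cost \<tau> (u x) (u y) < c)"
  shows "\<exists>l. limitin action_topology u l G"
proof -
  define \<epsilon> where "\<epsilon> n = inverse (real (Suc n))" for n
  have \<epsilon>_pos: "\<epsilon> n > 0" for n by (simp add: \<epsilon>_def)
  have ex_\<epsilon>: "\<exists>N. \<epsilon> N < e" if "e > 0" for e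
    using reals_Archimedean[OF that] by (simp add: \<epsilon>_def)
  have "\<exists>P. \<forall>n. eventually (P n) G \<and>
      (\<forall>x y. P n x \<longrightarrow> P n y \<longrightarrow> u x \<in> X \<and> u y \<in> X \<and> cost (\<epsilon> n) (u x) (u y) < \<epsilon> n)"
    using Cauchy[OF \<epsilon>_pos \<epsilon>_pos] by (intro choice) blast
  then obtain P where P_ev: "\<And>n. eventually (P n) G"
    and P_X: "\<And>n x. P n x \<Longrightarrow> u x \<in> X"
    and P_cost: "\<And>n x y. P n x \<Longrightarrow> P n y \<Longrightarrow> cost (\<epsilon> n) (u x) (u y) < \<epsilon> n"
    by metis
  have small: "\<exists>N. \<forall>x y. P N x \<longrightarrow> P N y \<longrightarrow> cost \<tau> (u x) (u y) < c"
    if "\<tau> > 0" "c > 0" for \<tau> c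
  proof -
    have "min \<tau> c > 0" using that by simp
    then obtain N where N: "\<epsilon> N < min \<tau> c" using ex_\<epsilon> by blast
    have "cost \<tau> (u x) (u y) < c" if "P N x" "P N y" for x y
    proof -
      have "cost \<tau> (u x) (u y) \<le> cost (\<epsilon> N) (u x) (u y)"
        using N \<epsilon>_pos[of N] P_X that by (intro cost_antimono) auto
      also have "\<dots> < \<epsilon> N" using P_cost that by blast
      finally show ?thesis using N by simp
    qed
    then show ?thesis by blast
  qed
  have "\<exists>x. \<forall>k\<le>n. P k x" for n
  proof (rule eventually_happens'[OF nontrivial])
    show "\<forall>\<^sub>F x in G. \<forall>k\<le>n. P k x"
      using P_ev by (simp add: eventually_ball_finite_distrib[of "{..n}", simplified Ball_def atMost_iff])
  qed
  then obtain x where x: "\<And>n k. k \<le> n \<Longrightarrow> P k (x n)" by metis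
  have "action_Cauchy (u \<circ> x)"
    unfolding action_Cauchy_def
  proof (intro conjI allI impI)
    show "range (u \<circ> x) \<subseteq> X" using P_X[OF x[OF order_refl]] by auto
    fix \<tau> c :: real assume "\<tau> > 0" "c > 0"
    then obtain N where "\<forall>y z. P N y \<longrightarrow> P N z \<longrightarrow> cost \<tau> (u y) (u z) < c" using small by blast
    then show "\<exists>N. \<forall>n\<ge>N. \<forall>m\<ge>N. cost \<tau> ((u \<circ> x) n) ((u \<circ> x) m) < c"
      using x by (intro exI[of _ N]) auto
  qed
  then obtain l where l: "limitin action_topology (u \<circ> x) l sequentially"
    using complete unfolding action_complete_def by blast
  then have lX: "l \<in> X" by (simp add: limitin_action_topology)
  have "\<forall>\<^sub>F s in G. u s \<in> X \<and> cost \<tau> (u s) l < c" if "\<tau> > 0" "c > 0" for \<tau> c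
  proof -
    have half: "\<tau>/2 > 0" "c/2 > 0" using that by auto
    obtain N where N: "\<And>y z. P N y \<Longrightarrow> P N z \<Longrightarrow> cost (\<tau>/2) (u y) (u z) < c/2"
      using small[OF half] by blast
    have "\<forall>\<^sub>F n in sequentially. cost (\<tau>/2) ((u \<circ> x) n) l < c/2 \<and> n \<ge> N"
    proof (rule eventually_conj[OF _ eventually_ge_at_top])
      have "\<forall>\<^sub>F n in sequentially. (u \<circ> x) n \<in> X \<and> cost (\<tau>/2) ((u \<circ> x) n) l < c/2"
        using l half unfolding limitin_action_topology by blast
      then show "\<forall>\<^sub>F n in sequentially. cost (\<tau>/2) ((u \<circ> x) n) l < c/2"
        by (rule eventually_mono) simp
    qed
    from eventually_happens'[OF _ this]
    obtain n where n: "cost (\<tau>/2) (u (x n)) l < c/2" "n \<ge> N" by auto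
    show ?thesis
    proof (rule eventually_mono[OF P_ev[of N]])
      fix s assume s: "P N s"
      have "cost (\<tau>/2 + \<tau>/2) (u s) l \<le> cost (\<tau>/2) (u s) (u (x n)) + cost (\<tau>/2) (u (x n)) l"
        using that s n(2) x P_X lX by (intro cost_triangle) auto
      then show "u s \<in> X \<and> cost \<tau> (u s) l < c"
        using N[OF s x[OF n(2)]] n(1) P_X[OF s] by simp
    qed
  qed
  then show ?thesis using lX unfolding limitin_action_topology by blast
qed

end

section \<open>Curves controlled by a real function\<close>

locale controlled_curve = action_space X cost
  for X :: "'a set" and cost :: "real \<Rightarrow> 'a \<Rightarrow> 'a \<Rightarrow> real" +
  fixes u :: "real \<Rightarrow> 'a" and a b :: real and F :: "real \<Rightarrow> real"
  assumes curve_in_X: "t \<in> {a..b} \<Longrightarrow> u t \<in> X"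
    and cost_le_increment:
      "\<lbrakk>a \<le> s; s < t; t \<le> b\<rbrakk> \<Longrightarrow> cost (t - s) (u s) (u t) \<le> F t - F s"
begin

lemma control_mono: "mono_on {a..b} F"
proof (rule mono_onI)
  fix s t assume st: "s \<in> {a..b}" "t \<in> {a..b}" "s \<le> t"
  show "F s \<le> F t"
  proof (cases "s = t")
    case False
    then have "0 \<le> cost (t - s) (u s) (u t)" using st curve_in_X by (intro cost_nonneg) auto
    also have "\<dots> \<le> F t - F s" using st False by (intro cost_le_increment) auto
    finally show ?thesis by simp
  qed simp
qed

lemma control_bounded_variation: "bounded_variation_on_interval F a b"
  unfolding bounded_variation_on_interval_def
proof (intro exI allI impI)
  fix M t assume p: "interval_partition a b M t"
  note in_Icc = interval_partition_bounds[OF p]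
  have "(\<Sum>j<M. \<bar>F (t (Suc j)) - F (t j)\<bar>) = (\<Sum>j<M. F (t (Suc j)) - F (t j))"
  proof (intro sum.cong refl abs_of_nonneg)
    fix j assume "j \<in> {..<M}"
    then show "0 \<le> F (t (Suc j)) - F (t j)"
      using mono_onD[OF control_mono in_Icc in_Icc, of j "Suc j"] p
      by (simp add: interval_partition_def less_imp_le)
  qed
  also have "\<dots> = F b - F a"
    using sum_lessThan_telescope[of "\<lambda>j. F (t j)" M] p by (simp add: interval_partition_def)
  finally show "(\<Sum>j<M. \<bar>F (t (Suc j)) - F (t j)\<bar>) \<le> F b - F a" by simp
qed

text \<open>A bound on the cost over the true time step bounds the cost over every longer time; the
  absolute values make the estimate symmetric, so that one argument serves both sides of a point.\<close>

lemma cost_le_abs_increment: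
  assumes "s \<in> {a..b}" "t \<in> {a..b}" "\<tau> > 0" "\<bar>t - s\<bar> \<le> \<tau>"
  shows "cost \<tau> (u s) (u t) \<le> \<bar>F t - F s\<bar>"
  using assms
proof (induction s t rule: linorder_wlog)
  case (le s t)
  show ?case
  proof (cases "s = t")
    case True
    then show ?thesis using le curve_in_X by simp
  next
    case False
    then have "cost \<tau> (u s) (u t) \<le> cost (t - s) (u s) (u t)"
      using le curve_in_X by (intro cost_antimono) auto
    also have "\<dots> \<le> F t - F s" using le False by (intro cost_le_increment) auto
    finally show ?thesis by simp
  qed
next
  case (sym s t)
  then show ?case using cost_sym[of \<tau> "u s" "u t"] curve_in_X by (simp add: abs_minus_commute)
qed

lemma curve_limit_exists:
  assumes complete: action_complete
    and "G \<noteq> bot" "\<forall>\<^sub>F s in G. s \<in> {a..b}"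
    and id_lim: "((\<lambda>s. s) \<longlongrightarrow> t) G" and F_lim: "(F \<longlongrightarrow> L) G"
  shows "\<exists>l. limitin action_topology u l G"
proof (rule Cauchy_filter_converges[OF complete \<open>G \<noteq> bot\<close>])
  fix \<tau> c :: real assume pos: "\<tau> > 0" "c > 0"
  let ?P = "\<lambda>s. s \<in> {a..b} \<and> dist s t < \<tau>/2 \<and> dist (F s) L < c/2"
  have "eventually ?P G"
    using assms(3) tendstoD[OF id_lim, of "\<tau>/2"] tendstoD[OF F_lim, of "c/2"] pos
    by (intro eventually_conj) auto
  moreover have "cost \<tau> (u x) (u y) < c" if "?P x" "?P y" for x y
  proof -
    have "\<bar>y - x\<bar> \<le> \<tau>" "\<bar>F y - F x\<bar> < c" using that unfolding dist_real_def by linarith+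
    then show ?thesis using cost_le_abs_increment[of x y \<tau>] that pos by auto
  qed
  ultimately show "\<exists>P. eventually P G \<and>
      (\<forall>x y. P x \<longrightarrow> P y \<longrightarrow> u x \<in> X \<and> u y \<in> X \<and> cost \<tau> (u x) (u y) < c)"
    using curve_in_X by (intro exI[of _ ?P]) blast
qed

lemma curve_limit_at_continuity:
  assumes "t \<in> {a..b}" "\<forall>\<^sub>F s in G. s \<in> {a..b}"
    and id_lim: "((\<lambda>s. s) \<longlongrightarrow> t) G" and F_lim: "(F \<longlongrightarrow> F t) G"
  shows "limitin action_topology u (u t) G"
  unfolding limitin_action_topology
proof (intro conjI allI impI)
  show "u t \<in> X" using assms(1) by (rule curve_in_X)
  fix \<tau> c :: real assume pos: "\<tau> > 0" "c > 0"
  have "\<forall>\<^sub>F s in G. s \<in> {a..b} \<and> dist s t < \<tau> \<and> dist (F s) (F t) < c"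
    using assms(2) tendstoD[OF id_lim] tendstoD[OF F_lim] pos by (intro eventually_conj) auto
  then show "\<forall>\<^sub>F s in G. u s \<in> X \<and> cost \<tau> (u s) (u t) < c"
  proof (rule eventually_mono)
    fix s assume s: "s \<in> {a..b} \<and> dist s t < \<tau> \<and> dist (F s) (F t) < c"
    then have "cost \<tau> (u s) (u t) \<le> \<bar>F t - F s\<bar>"
      using assms(1) pos by (intro cost_le_abs_increment) (auto simp: dist_real_def)
    then show "u s \<in> X \<and> cost \<tau> (u s) (u t) < c"
      using s curve_in_X by (auto simp: dist_real_def)
  qed
qed

lemma eventually_at_left_Icc: "t \<in> {a<..b} \<Longrightarrow> \<forall>\<^sub>F s in at_left t. s \<in> {a..b}"
  unfolding eventually_at_left_field by (intro exI[of _ a]) auto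

lemma eventually_at_right_Icc: "t \<in> {a..<b} \<Longrightarrow> \<forall>\<^sub>F s in at_right t. s \<in> {a..b}"
  unfolding eventually_at_right_field by (intro exI[of _ b]) auto

lemma curve_left_limit_exists:
  assumes action_complete "t \<in> {a<..b}"
  shows "\<exists>l. limitin action_topology u l (at_left t)"
proof -
  have "(F \<longlongrightarrow> Sup (F ` ({..<t} \<inter> {a..}))) (at t within ({..<t} \<inter> {a..}))"
    using assms(2) by (intro Lim_left_bound[where K = "F t"] mono_onD[OF control_mono]) auto
  moreover have "at t within ({..<t} \<inter> {a..}) = at_left t"
    using assms(2) by (intro at_within_nhd[of t "{a<..}"]) auto
  ultimately have "(F \<longlongrightarrow> Sup (F ` ({..<t} \<inter> {a..}))) (at_left t)" by simp
  then show ?thesis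
    using assms eventually_at_left_Icc by (intro curve_limit_exists) (auto intro: tendsto_ident_at)
qed

lemma curve_right_limit_exists:
  assumes action_complete "t \<in> {a..<b}"
  shows "\<exists>l. limitin action_topology u l (at_right t)"
proof -
  have "(F \<longlongrightarrow> Inf (F ` ({t<..} \<inter> {..b}))) (at t within ({t<..} \<inter> {..b}))"
    using assms(2) by (intro Lim_right_bound[where K = "F t"] mono_onD[OF control_mono]) auto
  moreover have "at t within ({t<..} \<inter> {..b}) = at_right t"
    using assms(2) by (intro at_within_nhd[of t "{..<b}"]) auto
  ultimately have "(F \<longlongrightarrow> Inf (F ` ({t<..} \<inter> {..b}))) (at_right t)" by simp
  then show ?thesis
    using assms eventually_at_right_Icc by (intro curve_limit_exists) (auto intro: tendsto_ident_at)
qed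

lemma jump_set_countable: "countable (jump_set u a b)"
proof (rule countable_subset[OF _ mono_on_ctble_discont[OF control_mono]])
  have "left_limit u a t = u t \<and> right_limit u b t = u t"
    if t: "t \<in> {a..b}" and cont: "continuous (at t within {a..b}) F" for t
  proof
    have F_lim: "(F \<longlongrightarrow> F t) (at t within {a..b})"
      using cont by (simp add: continuous_within)
    show "left_limit u a t = u t"
    proof (cases "t = a")
      case False
      then have ev: "\<forall>\<^sub>F s in at_left t. s \<in> {a..b}" using t by (intro eventually_at_left_Icc) auto
      then have "at_left t \<le> at t within {a..b}"
        unfolding at_within_def le_inf_iff le_principal eventually_inf_principal
        by (auto elim: eventually_mono)
      then have "limitin action_topology u (u t) (at_left t)"
        using t ev F_lim
        by (intro curve_limit_at_continuity tendsto_ident_at) (auto intro: tendsto_mono)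
      then show ?thesis using False by (rule left_limit_eqI)
    qed (simp add: left_limit_def)
    show "right_limit u b t = u t"
    proof (cases "t = b")
      case False
      then have ev: "\<forall>\<^sub>F s in at_right t. s \<in> {a..b}" using t by (intro eventually_at_right_Icc) auto
      then have "at_right t \<le> at t within {a..b}"
        unfolding at_within_def le_inf_iff le_principal eventually_inf_principal
        by (auto elim: eventually_mono)
      then have "limitin action_topology u (u t) (at_right t)"
        using t ev F_lim
        by (intro curve_limit_at_continuity tendsto_ident_at) (auto intro: tendsto_mono)
      then show ?thesis using False by (rule right_limit_eqI)
    qed (simp add: right_limit_def)
  qed
  then show "jump_set u a b \<subseteq> {t \<in> {a..b}. \<not> continuous (at t within {a..b}) F}"
    unfolding jump_set_def left_jump_set_def right_jump_set_def by auto
qed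

end

section \<open>The action as a controlling function\<close>

context action_space
begin

text \<open>Appending \<open>t\<close> to a partition of \<open>[a,s]\<close> adds one term to its sum, and this carries over
  to the supremum. The embedding into \<open>ennreal\<close> truncates negative reals, so it respects this
  addition because the costs are nonnegative.\<close>

lemma action_extend:
  assumes u: "u \<in> {a..b} \<rightarrow> X" and "a \<le> s" "s < t" "t \<le> b"
  shows "action u a s + ennreal (cost (t - s) (u s) (u t)) \<le> action u a t"
proof -
  let ?I = "{(M, p). interval_partition a s M p}"
  let ?S = "\<lambda>M p. \<Sum>j<M. cost (p (Suc j) - p j) (u (p j)) (u (p (Suc j)))"
  have "?I \<noteq> {}" using interval_partition_exists[OF \<open>a \<le> s\<close>] by auto
  then have "action u a s + ennreal (cost (t - s) (u s) (u t)) =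
      (SUP (M, p)\<in>?I. ennreal (?S M p) + ennreal (cost (t - s) (u s) (u t)))"
    unfolding action_def by (subst ennreal_SUP_add_left[symmetric]) (auto simp: case_prod_beta)
  also have "\<dots> \<le> action u a t"
  proof (rule SUP_least, clarify)
    fix M p assume p: "interval_partition a s M p"
    have inX: "u (p j) \<in> X" if "j \<le> M" for j
      using interval_partition_bounds[OF p that] u assms(3,4) by auto
    have "0 \<le> ?S M p"
      using p inX by (intro sum_nonneg cost_nonneg) (auto simp: interval_partition_def)
    moreover have "0 \<le> cost (t - s) (u s) (u t)"
      using u assms by (intro cost_nonneg) auto
    moreover have "?S (Suc M) (p(Suc M := t)) = ?S M p + cost (t - s) (u s) (u t)"
      using p by (simp add: interval_partition_def)
    ultimately have "ennreal (?S M p) + ennreal (cost (t - s) (u s) (u t)) =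
        ennreal (?S (Suc M) (p(Suc M := t)))"
      by (simp only: ennreal_plus)
    also have "\<dots> \<le> action u a t"
      unfolding action_def
      using interval_partition_snoc[OF p \<open>s < t\<close>]
      by (intro SUP_upper2[of "(Suc M, p(Suc M := t))"]) auto
    finally show "ennreal (?S M p) + ennreal (cost (t - s) (u s) (u t)) \<le> action u a t" .
  qed
  finally show ?thesis .
qed

lemma action_mono:
  assumes u: "u \<in> {a..b} \<rightarrow> X" and "a \<le> s" "s \<le> t" "t \<le> b"
  shows "action u a s \<le> action u a t"
proof (cases "s = t")
  case False
  have "action u a s \<le> action u a s + ennreal (cost (t - s) (u s) (u t))" by simp
  also have "\<dots> \<le> action u a t" using assms False by (intro action_extend) auto
  finally show ?thesis .
qed simp

lemma action_controls:
  assumes u: "u \<in> {a..b} \<rightarrow> X" and finite: "action u a b < \<infinity>"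
  shows "controlled_curve X cost u a b (\<lambda>t. enn2real (action u a t))"
proof
  show "u t \<in> X" if "t \<in> {a..b}" for t using u that by auto
  fix s t assume st: "a \<le> s" "s < t" "t \<le> b"
  have fin: "action u a r < top" if "a \<le> r" "r \<le> b" for r
    using action_mono[OF u that(1,2)] finite that by (auto intro: le_less_trans)
  have nonneg: "0 \<le> cost (t - s) (u s) (u t)" using u st by (intro cost_nonneg) auto
  have "enn2real (action u a s + ennreal (cost (t - s) (u s) (u t))) \<le> enn2real (action u a t)"
    using action_extend[OF u st] fin st by (intro enn2real_mono) auto
  then show "cost (t - s) (u s) (u t) \<le> enn2real (action u a t) - enn2real (action u a s)"
    using fin[of s] st nonneg by (simp add: enn2real_plus)
qed

end

theorem proposition5p3:
  fixes X :: "'a set" and cost :: "real \<Rightarrow> 'a \<Rightarrow> 'a \<Rightarrow> real"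
    and u :: "real \<Rightarrow> 'a" and a b :: real
  assumes "action_space X cost"
    and "action_space.action_complete X cost"
    and "a \<le> b"
    and "u \<in> {a..b} \<rightarrow> X"
    and "action_space.action cost u a b < \<infinity>"
  shows "(\<forall>t\<in>{a<..b}. \<exists>l. limitin (action_space.action_topology X cost) u l (at_left t)) \<and>
    (\<forall>t\<in>{a..<b}. \<exists>l. limitin (action_space.action_topology X cost) u l (at_right t)) \<and>
    countable (action_space.jump_set X cost u a b) \<and>
    (\<forall>t\<in>{a..b}. action_space.action cost u a t < \<infinity>) \<and>
    bounded_variation_on_interval (\<lambda>t. enn2real (action_space.action cost u a t)) a b"
proof -
  interpret action_space X cost by fact
  interpret controlled_curve X cost u a b "\<lambda>t. enn2real (action u a t)"
    using assms(4,5) by (rule action_controls)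
  have "action u a t < \<infinity>" if "t \<in> {a..b}" for t
    using action_mono[OF assms(4), of t b] assms(5) that by (auto intro: le_less_trans)
  then show ?thesis
    using curve_left_limit_exists[OF assms(2)] curve_right_limit_exists[OF assms(2)]
      jump_set_countable control_bounded_variation by blast
qed

end
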